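(* Up to isomorphism, there is precisely one symmetric association scheme $\mathcal{A} = (X, \{R_0, \dots, R_5\})$ with $R_0 = \mathrm{Id}_X$ whose intersection numbers, written as matrices $(p^h_{ij})_{i,j=0}^5$ for $h = 0,\dots,5$ (rows indexed by $i$, columns by $j$), are: $(p^0_{ij}) = \mathrm{diag}(1, 12, 2, 1, 12, 12)$; $(p^1_{ij})$ has rows $(0,1,0,0,0,0)$, $(1,5,1,0,4,1)$, $(0,1,0,0,0,1)$, $(0,0,0,0,0,1)$, $(0,4,0,0,4,4)$, $(0,1,1,1,4,5)$; $(p^2_{ij})$ has rows $(0,0,1,0,0,0)$, $(0,6,0,0,0,6)$, $(1,0,0,1,0,0)$, $(0,0,1,0,0,0)$, $(0,0,0,0,12,0)$, $(0,0,0,0,0,6)$; $(p^3_{ij})$ has rows $(0,0,0,1,0,0)$, $(0,0,0,0,0,12)$, $(0,0,2,0,0,0)$, $(1,0,0,0,0,0)$, $(0,0,0,0,12,0)$, $(0,12,0,0,0,0)$; $(p^4_{ij})$ has rows $(0,0,0,0,1,0)$, $(0,4,0,0,4,4)$, $(0,0,0,0,2,0)$, $(0,0,0,0,1,0)$, $(1,4,2,1,0,4)$, $(0,4,0,0,4,4)$; $(p^5_{ij})$ has rows $(0,0,0,0,0,1)$, $(0,1,1,1,4,5)$, $(0,1,0,0,0,1)$, $(0,1,0,0,0,0)$, $(0,4,0,0,4,4)$, $(1,5,1,0,4,1)$.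
   Context: A symmetric association scheme is a pair $(X, \{R_i \mid i \in \mathcal{I}\})$ where $X$ is a finite set and the $R_i$ are nonempty symmetric binary relations on $X$ partitioning $X^2$, with $R_0$ the identity relation, such that for all $h,i,j$ there is a number $p^h_{ij}$ (intersection number) with the property that for every $(x,y) \in R_h$ there are exactly $p^h_{ij}$ vertices $z$ with $(x,z) \in R_i$ and $(z,y) \in R_j$. Two schemes $(X,\mathcal{R})$, $(X',\mathcal{R}')$ are isomorphic if there are bijections $\phi: X \to X'$ and $\psi: \mathcal{R} \to \mathcal{R}'$ such that $(x,y) \in R$ iff $(\phi(x),\phi(y)) \in \psi(R)$ for all $x,y \in X$, $R \in \mathcal{R}$. (Such a scheme has $40$ vertices.)
   Formalization: The last row of (p^2_ij) is taken as (0,6,0,0,0,6) instead of (0,0,0,0,0,6): in a symmetric scheme p^2_51 = p^2_15 = 6, so no scheme has the table as printed. *)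

theory Defs
  imports Main "HOL-Library.Disjoint_Sets"
begin

locale sym_assoc_scheme =
  fixes X :: "'a set" and I :: "'i::zero set" and R :: "'i \<Rightarrow> ('a \<times> 'a) set"
  assumes finite_vertices: "finite X"
    and zero_index: "0 \<in> I"
    and nonempty: "\<And>i. i \<in> I \<Longrightarrow> R i \<noteq> {}"
    and symmetric: "\<And>i. i \<in> I \<Longrightarrow> sym (R i)"
    and disjoint: "disjoint_family_on R I"
    and cover: "(\<Union>i\<in>I. R i) = X \<times> X"
    and identity: "R 0 = Id_on X"
    and regular: "\<And>h i j. h \<in> I \<Longrightarrow> i \<in> I \<Longrightarrow> j \<in> I \<Longrightarrow>
      \<exists>p. \<forall>(x, y) \<in> R h. card {z \<in> X. (x, z) \<in> R i \<and> (z, y) \<in> R j} = p"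

text \<open>The intersection number \<open>p\<^sup>h\<^sub>i\<^sub>j\<close>. In a scheme it is well defined, because
  \<open>R h\<close> is nonempty.\<close>

definition intersection_number ::
    "'a set \<Rightarrow> ('i \<Rightarrow> ('a \<times> 'a) set) \<Rightarrow> 'i \<Rightarrow> 'i \<Rightarrow> 'i \<Rightarrow> nat" where
  "intersection_number X R h i j =
    (THE p. \<forall>(x, y) \<in> R h. card {z \<in> X. (x, z) \<in> R i \<and> (z, y) \<in> R j} = p)"

text \<open>The relations enter as unindexed sets, so an isomorphism may permute the indices.\<close>

definition scheme_isomorphic ::
    "'a set \<Rightarrow> ('a \<times> 'a) set set \<Rightarrow> 'b set \<Rightarrow> ('b \<times> 'b) set set \<Rightarrow> bool" where
  "scheme_isomorphic X \<R> X' \<R>' \<longleftrightarrow>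
    (\<exists>\<phi> \<psi>. bij_betw \<phi> X X' \<and> bij_betw \<psi> \<R> \<R>' \<and>
      (\<forall>x\<in>X. \<forall>y\<in>X. \<forall>r\<in>\<R>. (x, y) \<in> r \<longleftrightarrow> (\<phi> x, \<phi> y) \<in> \<psi> r))"

text \<open>Entry \<open>scheme40_numbers ! h ! i ! j\<close> is the prescribed \<open>p\<^sup>h\<^sub>i\<^sub>j\<close>. The last row for
  \<open>h = 2\<close> is \<open>[0,6,0,0,0,6]\<close>: symmetry of the relations forces \<open>p\<^sup>2\<^sub>5\<^sub>1 = p\<^sup>2\<^sub>1\<^sub>5 = 6\<close>, so the
  row \<open>(0,0,0,0,0,6)\<close> found in the source is a misprint that no scheme satisfies.\<close>

definition scheme40_numbers :: "nat list list list" where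
  "scheme40_numbers =
   [[[1, 0, 0, 0, 0, 0],
     [0,12, 0, 0, 0, 0],
     [0, 0, 2, 0, 0, 0],
     [0, 0, 0, 1, 0, 0],
     [0, 0, 0, 0,12, 0],
     [0, 0, 0, 0, 0,12]],
    [[0, 1, 0, 0, 0, 0],
     [1, 5, 1, 0, 4, 1],
     [0, 1, 0, 0, 0, 1],
     [0, 0, 0, 0, 0, 1],
     [0, 4, 0, 0, 4, 4],
     [0, 1, 1, 1, 4, 5]],
    [[0, 0, 1, 0, 0, 0],
     [0, 6, 0, 0, 0, 6],
     [1, 0, 0, 1, 0, 0],
     [0, 0, 1, 0, 0, 0],
     [0, 0, 0, 0,12, 0],
     [0, 6, 0, 0, 0, 6]],
    [[0, 0, 0, 1, 0, 0],
     [0, 0, 0, 0, 0,12],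
     [0, 0, 2, 0, 0, 0],
     [1, 0, 0, 0, 0, 0],
     [0, 0, 0, 0,12, 0],
     [0,12, 0, 0, 0, 0]],
    [[0, 0, 0, 0, 1, 0],
     [0, 4, 0, 0, 4, 4],
     [0, 0, 0, 0, 2, 0],
     [0, 0, 0, 0, 1, 0],
     [1, 4, 2, 1, 0, 4],
     [0, 4, 0, 0, 4, 4]],
    [[0, 0, 0, 0, 0, 1],
     [0, 1, 1, 1, 4, 5],
     [0, 1, 0, 0, 0, 1],
     [0, 1, 0, 0, 0, 0],
     [0, 4, 0, 0, 4, 4],
     [1, 5, 1, 0, 4, 1]]]"

definition is_scheme40 :: "'a set \<Rightarrow> (nat \<Rightarrow> ('a \<times> 'a) set) \<Rightarrow> bool" where
  "is_scheme40 X R \<longleftrightarrow> sym_assoc_scheme X {0..5} R \<and>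
    (\<forall>h\<in>{0..5}. \<forall>i\<in>{0..5}. \<forall>j\<in>{0..5}.
      intersection_number X R h i j = scheme40_numbers ! h ! i ! j)"

end

theory Submission
  imports Defs "HOL-Library.Countable"
begin

text \<open>
  The scheme lives on the 40 roots of the root system \<open>D\<^sub>5\<close>, the integer vectors of squared length 2
  in dimension 5: the relations 0, 1, 5, 3 are given by the inner products 2, 1, -1, -2, and
  orthogonal roots are in relation 2 or 4 according to whether or not they are congruent modulo 2.
  Since reflections act transitively on the roots, it suffices to count from a single root.

  Conversely, the intersection numbers of a scheme say that the matrix G with entries
  2, 1, 0, -2, 0, -1 on the relations 0 to 5 satisfies \<open>G\<^sup>2 = 16 G\<close> and has trace 80, so
  \<open>G / 16\<close> is a projection of rank 5. Five explicit orthogonal integer vectors in its image turn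
  the vertices into integer vectors with Gram matrix G, that is, into the 40 roots of \<open>D\<^sub>5\<close>.
\<close>

section \<open>Schemes as relation-valued functions\<close>

text \<open>Here \<open>f x y\<close> is the index of the relation containing the pair \<open>(x, y)\<close>.\<close>

locale scheme40 =
  fixes X :: "'a set" and f :: "'a \<Rightarrow> 'a \<Rightarrow> nat"
  assumes fin: "finite X"
    and ne: "X \<noteq> {}"
    and le5: "x \<in> X \<Longrightarrow> y \<in> X \<Longrightarrow> f x y \<le> 5"
    and eq0: "x \<in> X \<Longrightarrow> y \<in> X \<Longrightarrow> f x y = 0 \<longleftrightarrow> x = y"
    and comm: "x \<in> X \<Longrightarrow> y \<in> X \<Longrightarrow> f x y = f y x"
    and count: "x \<in> X \<Longrightarrow> y \<in> X \<Longrightarrow> i \<le> 5 \<Longrightarrow> j \<le> 5 \<Longrightarrow>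
      card {z \<in> X. f x z = i \<and> f z y = j} = scheme40_numbers ! f x y ! i ! j"

lemma le5_cases:
  fixes i :: nat
  assumes "i \<le> 5"
  obtains "i = 0" | "i = 1" | "i = 2" | "i = 3" | "i = 4" | "i = 5"
  using assms by linarith

text \<open>The relations partition \<open>X \<times> X\<close>, so on that set the definite
  description picks the one index of a pair; the values of \<open>f\<close> elsewhere do not
  matter.\<close>

lemma is_scheme40_imp_index:
  assumes "is_scheme40 X R"
  shows "\<exists>f. scheme40 X f \<and> (\<forall>i\<le>5. R i = {(x, y). x \<in> X \<and> y \<in> X \<and> f x y = i})"
proof -
  interpret sym_assoc_scheme X "{0..5}" R
    using assms by (simp add: is_scheme40_def)
  define f where "f x y = (THE i. i \<le> 5 \<and> (x, y) \<in> R i)" for x y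
  have sub: "x \<in> X \<and> y \<in> X" if "(x, y) \<in> R i" "i \<le> 5" for x y i
  proof -
    have "(x, y) \<in> (\<Union>i\<in>{0..5}. R i)" using that by auto
    then show ?thesis using cover by simp
  qed
  have uniq: "i = j" if "(x, y) \<in> R i" "(x, y) \<in> R j" "i \<le> 5" "j \<le> 5" for x y i j
    using disjoint that unfolding disjoint_family_on_def
    by (metis IntI atLeastAtMost_iff empty_iff zero_le)
  have f_eq: "f x y = i" if "(x, y) \<in> R i" "i \<le> 5" for x y i
    unfolding f_def using that uniq by (intro the_equality) auto
  have ex: "\<exists>i\<le>5. (x, y) \<in> R i" if "x \<in> X" "y \<in> X" for x y
  proof -
    have "(x, y) \<in> (\<Union>i\<in>{0..5}. R i)" using that cover by auto
    then show ?thesis by auto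
  qed
  have f_iff: "(x, y) \<in> R i \<longleftrightarrow> f x y = i" if "x \<in> X" "y \<in> X" "i \<le> 5" for x y i
    using ex[OF that(1,2)] f_eq that(3) by blast
  have f_le: "f x y \<le> 5" if "x \<in> X" "y \<in> X" for x y
    using ex[OF that] f_eq by blast
  \<comment> \<open>The pair \<open>(x, y)\<close> in \<open>R h\<close> makes the witness
    \<open>p\<close> of regularity unique, so the definite description in
    \<open>intersection_number\<close> evaluates to it.\<close>
  have num: "card {z \<in> X. (x, z) \<in> R i \<and> (z, y) \<in> R j} = scheme40_numbers ! h ! i ! j"
    if xy: "(x, y) \<in> R h" and le: "h \<le> 5" "i \<le> 5" "j \<le> 5" for x y h i j
  proof -
    obtain p where p: "\<forall>(x, y) \<in> R h. card {z \<in> X. (x, z) \<in> R i \<and> (z, y) \<in> R j} = p"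
      using regular[of h i j] le by auto
    have "intersection_number X R h i j = p"
      unfolding intersection_number_def
      using p xy by (intro the_equality) auto
    moreover have "intersection_number X R h i j = scheme40_numbers ! h ! i ! j"
      using assms le by (simp add: is_scheme40_def)
    ultimately show ?thesis using p xy by auto
  qed
  have "scheme40 X f"
  proof
    show "finite X" by (rule finite_vertices)
    show "X \<noteq> {}" using nonempty[of 0] sub[of _ _ 0] by auto
    show "f x y \<le> 5" if "x \<in> X" "y \<in> X" for x y using f_le that .
    show "f x y = 0 \<longleftrightarrow> x = y" if "x \<in> X" "y \<in> X" for x y
      using f_iff[OF that, of 0] identity that by auto
    show "f x y = f y x" if "x \<in> X" "y \<in> X" for x y
    proof -
      have "(x, y) \<in> R (f x y)" using f_iff that f_le by blast
      then have "(y, x) \<in> R (f x y)" using symmetric[of "f x y"] f_le[OF that] by (auto dest: symD)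
      then show ?thesis using f_iff[of y x "f x y"] f_le that by auto
    qed
    show "card {z \<in> X. f x z = i \<and> f z y = j} = scheme40_numbers ! f x y ! i ! j"
      if "x \<in> X" "y \<in> X" "i \<le> 5" "j \<le> 5" for x y i j
    proof -
      have "{z \<in> X. f x z = i \<and> f z y = j} = {z \<in> X. (x, z) \<in> R i \<and> (z, y) \<in> R j}"
        using f_iff[OF that(1) _ that(3)] f_iff[OF _ that(2) that(4)] by blast
      moreover have "(x, y) \<in> R (f x y)" using f_iff[of x y "f x y"] f_le that by simp
      ultimately show ?thesis using num[of x y "f x y" i j] f_le[OF that(1,2)] that(3,4) by simp
    qed
  qed
  moreover have "R i = {(x, y). x \<in> X \<and> y \<in> X \<and> f x y = i}" if "i \<le> 5" for i
  proof (intro set_eqI, clarify)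
    fix x y
    show "(x, y) \<in> R i \<longleftrightarrow> (x, y) \<in> {(x, y). x \<in> X \<and> y \<in> X \<and> f x y = i}"
      using sub[of x y i] f_iff[of x y i] \<open>i \<le> 5\<close> by blast
  qed
  ultimately show ?thesis by blast
qed

text \<open>These entries are the valencies. Their positivity makes every relation nonempty when a
  scheme is rebuilt from an index function.\<close>

lemma numbers_ne_0:
  "i \<le> 5 \<Longrightarrow> scheme40_numbers ! 0 ! i ! i \<noteq> 0"
  by (erule le5_cases) (simp_all add: scheme40_numbers_def numeral_eq_Suc)

lemma index_imp_is_scheme40:
  assumes "scheme40 X f"
  shows "is_scheme40 X (\<lambda>i. {(x, y). x \<in> X \<and> y \<in> X \<and> f x y = i})" (is "is_scheme40 X ?R")
proof -
  interpret scheme40 X f by fact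
  have ne': "?R i \<noteq> {}" if "i \<le> 5" for i
  proof -
    obtain x where "x \<in> X" using ne by blast
    then have "card {z \<in> X. f x z = i \<and> f z x = i} \<noteq> 0"
      using count[of x x i i] numbers_ne_0[OF that] eq0[of x x] that by simp
    then have "{z \<in> X. f x z = i \<and> f z x = i} \<noteq> {}" by force
    then show ?thesis using \<open>x \<in> X\<close> by blast
  qed
  have num: "\<forall>(x, y) \<in> ?R h. card {z \<in> X. (x, z) \<in> ?R i \<and> (z, y) \<in> ?R j} = scheme40_numbers ! h ! i ! j"
    if "h \<le> 5" "i \<le> 5" "j \<le> 5" for h i j
  proof clarify
    fix x y assume "x \<in> X" "y \<in> X" "h = f x y"
    then show "card {z \<in> X. (x, z) \<in> ?R i \<and> (z, y) \<in> ?R j} = scheme40_numbers ! f x y ! i ! j"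
      using count[of x y i j] that by (simp cong: conj_cong)
  qed
  have "sym_assoc_scheme X {0..5} ?R"
  proof
    fix h i j :: nat assume "h \<in> {0..5}" "i \<in> {0..5}" "j \<in> {0..5}"
    then show "\<exists>p. \<forall>(x, y) \<in> ?R h. card {z \<in> X. (x, z) \<in> ?R i \<and> (z, y) \<in> ?R j} = p"
      by (intro exI) (rule num; simp)
  qed (use fin ne' eq0 comm le5 in \<open>auto simp: sym_def disjoint_family_on_def\<close>)
  moreover have "intersection_number X ?R h i j = scheme40_numbers ! h ! i ! j"
    if le: "h \<le> 5" "i \<le> 5" "j \<le> 5" for h i j
    unfolding intersection_number_def
  proof (rule the_equality)
    show "\<forall>(x, y) \<in> ?R h. card {z \<in> X. (x, z) \<in> ?R i \<and> (z, y) \<in> ?R j} = scheme40_numbers ! h ! i ! j"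
      by (rule num[OF le])
    fix p assume p: "\<forall>(x, y) \<in> ?R h. card {z \<in> X. (x, z) \<in> ?R i \<and> (z, y) \<in> ?R j} = p"
    obtain xy where xy: "xy \<in> ?R h" using ne'[OF le(1)] by (meson ex_in_conv)
    show "p = scheme40_numbers ! h ! i ! j"
      using bspec[OF num[OF le] xy] bspec[OF p xy] by (cases xy) simp
  qed
  ultimately show ?thesis by (simp add: is_scheme40_def)
qed

lemma scheme40_transport:
  assumes "scheme40 X f" "bij_betw g Y X"
  shows "scheme40 Y (\<lambda>x y. f (g x) (g y))"
proof -
  interpret scheme40 X f by fact
  have gX: "g x \<in> X" if "x \<in> Y" for x using assms(2) that by (auto simp: bij_betw_def)
  have inj: "inj_on g Y" using assms(2) by (simp add: bij_betw_def)
  show ?thesis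
  proof
    show "finite Y" using assms(2) fin by (simp add: bij_betw_finite)
    show "Y \<noteq> {}" using assms(2) ne by (auto simp: bij_betw_def)
    fix x y assume xy: "x \<in> Y" "y \<in> Y"
    show "f (g x) (g y) \<le> 5" "f (g x) (g y) = f (g y) (g x)"
      using xy gX le5 comm by auto
    show "f (g x) (g y) = 0 \<longleftrightarrow> x = y" using eq0 gX xy inj by (auto dest: inj_onD)
    fix i j :: nat assume ij: "i \<le> 5" "j \<le> 5"
    have "{z \<in> X. f (g x) z = i \<and> f z (g y) = j} = g ` {z \<in> Y. f (g x) (g z) = i \<and> f (g z) (g y) = j}"
      using assms(2) by (auto simp: bij_betw_def)
    moreover have "inj_on g {z \<in> Y. f (g x) (g z) = i \<and> f (g z) (g y) = j}"
      using inj by (auto intro: inj_on_subset)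
    ultimately show "card {z \<in> Y. f (g x) (g z) = i \<and> f (g z) (g y) = j}
        = scheme40_numbers ! f (g x) (g y) ! i ! j"
      using count[OF gX gX, OF xy ij] by (simp add: card_image)
  qed
qed

section \<open>The scheme of the root system\<close>

type_synonym vec5 = "int \<times> int \<times> int \<times> int \<times> int"

fun ip :: "vec5 \<Rightarrow> vec5 \<Rightarrow> int" where
  "ip (a, b, c, d, e) (a', b', c', d', e') = a * a' + b * b' + c * c' + d * d' + e * e'"

fun cong2 :: "vec5 \<Rightarrow> vec5 \<Rightarrow> bool" where
  "cong2 (a, b, c, d, e) (a', b', c', d', e') \<longleftrightarrow>
    even (a - a') \<and> even (b - b') \<and> even (c - c') \<and> even (d - d') \<and> even (e - e')"

text \<open>The last branch is meant for inner product 0. It also catches values outside -2 to 2,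
  which do not occur between roots, so that \<open>rel\<close> is total with values at most
  5.\<close>

definition rel :: "vec5 \<Rightarrow> vec5 \<Rightarrow> nat" where
  "rel v w = (let k = ip v w in
    if k = 2 then 0 else if k = 1 then 1 else if k = - 2 then 3 else if k = - 1 then 5
    else if cong2 v w then 2 else 4)"

definition roots :: "vec5 set" where
  "roots = {v. ip v v = 2}"

definition base_root :: vec5 where "base_root = (1, 1, 0, 0, 0)"

text \<open>The \<open>i\<close>-th list consists of the roots in relation \<open>i\<close> with \<open>base_root\<close>.\<close>

definition layers :: "vec5 list list" where
  "layers =
   [[(1,1,0,0,0)],
    [(0,1,-1,0,0), (0,1,0,-1,0), (0,1,0,0,-1), (0,1,0,0,1), (0,1,0,1,0), (0,1,1,0,0),
     (1,0,-1,0,0), (1,0,0,-1,0), (1,0,0,0,-1), (1,0,0,0,1), (1,0,0,1,0), (1,0,1,0,0)],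
    [(-1,1,0,0,0), (1,-1,0,0,0)],
    [(-1,-1,0,0,0)],
    [(0,0,-1,-1,0), (0,0,-1,0,-1), (0,0,-1,0,1), (0,0,-1,1,0), (0,0,0,-1,-1), (0,0,0,-1,1),
     (0,0,0,1,-1), (0,0,0,1,1), (0,0,1,-1,0), (0,0,1,0,-1), (0,0,1,0,1), (0,0,1,1,0)],
    [(-1,0,-1,0,0), (-1,0,0,-1,0), (-1,0,0,0,-1), (-1,0,0,0,1), (-1,0,0,1,0), (-1,0,1,0,0),
     (0,-1,-1,0,0), (0,-1,0,-1,0), (0,-1,0,0,-1), (0,-1,0,0,1), (0,-1,0,1,0), (0,-1,1,0,0)]]"

text \<open>The reflection of the second argument in the hyperplane orthogonal to the first. The
  usual factor 2 / (r, r) equals 1 when r is a root.\<close>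

fun reflect :: "vec5 \<Rightarrow> vec5 \<Rightarrow> vec5" where
  "reflect (a', b', c', d', e') (a, b, c, d, e) =
    (let k = ip (a', b', c', d', e') (a, b, c, d, e)
     in (a - k * a', b - k * b', c - k * c', d - k * d', e - k * e'))"

text \<open>Squared length 2 forces every coordinate into {-1, 0, 1}, so only 3^5 candidates have to
  be checked by evaluation.\<close>

lemma set_layers: "set (concat layers) = roots"
proof
  show "set (concat layers) \<subseteq> roots"
    by (simp add: layers_def roots_def)
  have enum: "list_all (\<lambda>v. ip v v = 2 \<longrightarrow> v \<in> set (concat layers))
    (List.product [-1, 0, 1] (List.product [-1, 0, 1]
      (List.product [-1, 0, 1] (List.product [-1, 0, 1] [-1, 0, 1]))))"
    by code_simp
  have small: "x \<in> {-1, 0, 1}" if "x * x \<le> 2" for x :: int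
  proof -
    have "\<not> 2 \<le> \<bar>x\<bar>"
    proof
      assume "2 \<le> \<bar>x\<bar>"
      then have "2 * 2 \<le> \<bar>x\<bar> * \<bar>x\<bar>" by (intro mult_mono) auto
      with that show False by simp
    qed
    then show ?thesis by auto
  qed
  show "roots \<subseteq> set (concat layers)"
  proof
    fix v assume "v \<in> roots"
    obtain a b c d e where v: "v = (a, b, c, d, e)" by (cases v)
    have s: "a * a + b * b + c * c + d * d + e * e = 2"
      using \<open>v \<in> roots\<close> v by (simp add: roots_def)
    have "0 \<le> a * a" "0 \<le> b * b" "0 \<le> c * c" "0 \<le> d * d" "0 \<le> e * e" by simp_all
    with s have "a * a \<le> 2" "b * b \<le> 2" "c * c \<le> 2" "d * d \<le> 2" "e * e \<le> 2"
      by linarith+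
    then have "a \<in> {-1, 0, 1}" "b \<in> {-1, 0, 1}" "c \<in> {-1, 0, 1}" "d \<in> {-1, 0, 1}" "e \<in> {-1, 0, 1}"
      by (simp_all only: small)
    then have "v \<in> set (List.product [-1, 0, 1] (List.product [-1, 0, 1]
        (List.product [-1, 0, 1] (List.product [-1, 0, 1] [-1, 0, 1]))))"
      unfolding v set_product list.set mem_Times_iff fst_conv snd_conv by (intro conjI)
    then show "v \<in> set (concat layers)"
      using enum \<open>v \<in> roots\<close> unfolding list_all_iff roots_def mem_Collect_eq by blast
  qed
qed

lemma distinct_layers: "distinct (concat layers)"
  by (simp add: layers_def)

lemma finite_roots: "finite roots"
  by (simp flip: set_layers)

lemma card_roots: "card roots = 40"
  using distinct_card[OF distinct_layers] unfolding set_layers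
  by (simp add: layers_def)

section \<open>Invariance of the relations under reflections\<close>

lemma ip_comm: "ip v w = ip w v"
  by (cases v; cases w) (simp add: mult.commute)

lemma cong2_comm: "cong2 v w = cong2 w v"
  by (cases v; cases w) auto

lemma rel_comm: "rel v w = rel w v"
  unfolding rel_def by (simp add: ip_comm[of v] cong2_comm[of v])

lemma rel_le5: "rel v w \<le> 5"
  by (simp add: rel_def Let_def)

lemma ip_reflect:
  assumes "r \<in> roots" shows "ip (reflect r v) (reflect r w) = ip v w"
proof -
  obtain a b c d e where r: "r = (a, b, c, d, e)" by (cases r)
  obtain a1 b1 c1 d1 e1 where v: "v = (a1, b1, c1, d1, e1)" by (cases v)
  obtain a2 b2 c2 d2 e2 where w: "w = (a2, b2, c2, d2, e2)" by (cases w)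
  \<comment> \<open>With \<open>k\<close> and \<open>l\<close> free this is a plain polynomial
    identity. For \<open>k = ip r v\<close>, \<open>l = ip r w\<close> and \<open>ip r r = 2\<close>
    the three correction terms cancel.\<close>
  have gen: "ip (a1 - k * a, b1 - k * b, c1 - k * c, d1 - k * d, e1 - k * e)
      (a2 - l * a, b2 - l * b, c2 - l * c, d2 - l * d, e2 - l * e)
    = ip v w - l * ip r v - k * ip r w + k * l * ip r r" for k l
    unfolding v w r by (simp add: algebra_simps)
  show ?thesis
    using gen[of "ip r v" "ip r w"] assms by (simp add: roots_def r v w Let_def)
qed

lemma reflect_roots: "r \<in> roots \<Longrightarrow> v \<in> roots \<Longrightarrow> reflect r v \<in> roots"
  using ip_reflect by (simp add: roots_def)

text \<open>Reflecting negates the inner product with \<open>r\<close>, so the second subtraction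
  restores what the first one took away.\<close>

lemma reflect_reflect:
  assumes "r \<in> roots" shows "reflect r (reflect r v) = v"
proof -
  obtain a b c d e where r: "r = (a, b, c, d, e)" by (cases r)
  obtain a1 b1 c1 d1 e1 where v: "v = (a1, b1, c1, d1, e1)" by (cases v)
  have "ip r (a1 - k * a, b1 - k * b, c1 - k * c, d1 - k * d, e1 - k * e) = ip r v - k * ip r r" for k
    unfolding v r by (simp add: algebra_simps)
  then have "ip r (reflect r v) = - ip r v"
    using assms by (simp add: roots_def r v Let_def)
  moreover have "reflect r v = (let k = ip r v in (a1 - k * a, b1 - k * b, c1 - k * c, d1 - k * d, e1 - k * e))"
    by (simp add: r v)
  ultimately show ?thesis
    by (simp add: r v Let_def del: ip.simps)
qed

text \<open>Vectors congruent modulo 2 have inner products with \<open>r\<close> of equal parity, so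
  congruent multiples of \<open>r\<close> are subtracted from them.\<close>

lemma cong2_reflect:
  assumes "cong2 v w" shows "cong2 (reflect r v) (reflect r w)"
proof -
  obtain a b c d e where r: "r = (a, b, c, d, e)" by (cases r)
  obtain a1 b1 c1 d1 e1 where v: "v = (a1, b1, c1, d1, e1)" by (cases v)
  obtain a2 b2 c2 d2 e2 where w: "w = (a2, b2, c2, d2, e2)" by (cases w)
  have "ip r v - ip r w = a * (a1 - a2) + b * (b1 - b2) + c * (c1 - c2) + d * (d1 - d2) + e * (e1 - e2)"
    unfolding r v w by (simp add: algebra_simps)
  then have "even (ip r v - ip r w)" using assms by (simp add: v w)
  then show ?thesis using assms unfolding r v w reflect.simps Let_def by auto
qed

lemma rel_reflect:
  assumes "r \<in> roots" shows "rel (reflect r v) (reflect r w) = rel v w"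
proof -
  have "cong2 (reflect r v) (reflect r w) = cong2 v w"
    using cong2_reflect[of v w r] cong2_reflect[of "reflect r v" "reflect r w" r] reflect_reflect[OF assms] by metis
  then show ?thesis using ip_reflect[OF assms] by (simp add: rel_def)
qed

section \<open>Regularity of the root scheme\<close>

definition regular_at :: "vec5 \<Rightarrow> bool" where
  "regular_at x \<longleftrightarrow> (\<forall>y\<in>roots. \<forall>i\<le>5. \<forall>j\<le>5.
    card {z \<in> roots. rel x z = i \<and> rel z y = j} = scheme40_numbers ! rel x y ! i ! j)"

text \<open>The reflection is an involution on the roots that preserves \<open>rel\<close>, so it
  matches the vertices counted for \<open>reflect r x\<close> and \<open>y\<close> with those
  counted for \<open>x\<close> and \<open>reflect r y\<close>.\<close>

lemma regular_at_reflect: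
  assumes "r \<in> roots" "regular_at x" shows "regular_at (reflect r x)"
  unfolding regular_at_def
proof (intro ballI allI impI)
  fix y i j assume y: "y \<in> roots" and ij: "i \<le> (5::nat)" "j \<le> (5::nat)"
  let ?y = "reflect r y"
  have rr: "reflect r (reflect r z) = z" for z by (rule reflect_reflect[OF assms(1)])
  have rx: "rel (reflect r x) z = rel x (reflect r z)" for z
    using rel_reflect[OF assms(1), of x "reflect r z"] by (simp add: rr)
  have ry: "rel (reflect r z) ?y = rel z y" for z
    by (rule rel_reflect[OF assms(1)])
  have "bij_betw (reflect r) {z \<in> roots. rel (reflect r x) z = i \<and> rel z y = j}
      {z \<in> roots. rel x z = i \<and> rel z ?y = j}" (is "bij_betw _ ?B ?A")
  proof (rule bij_betw_byWitness[where f' = "reflect r"])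
    show "reflect r ` ?B \<subseteq> ?A"
      using reflect_roots[OF assms(1)] by (auto simp: rx ry)
    show "reflect r ` ?A \<subseteq> ?B"
      using reflect_roots[OF assms(1)] by (auto simp: rx rr simp flip: ry)
  qed (simp_all add: rr)
  then have "card ?B = card ?A" by (rule bij_betw_same_card)
  also have "\<dots> = scheme40_numbers ! rel x ?y ! i ! j"
    using assms(2) reflect_roots[OF assms(1) y] ij unfolding regular_at_def by simp
  finally show "card ?B = scheme40_numbers ! rel (reflect r x) y ! i ! j" by (simp add: rx)
qed

text \<open>The difference \<open>x - y\<close> has squared length 2 - 2 + 2 = 2, hence is a root,
  and the reflection in it sends \<open>y\<close> to \<open>x\<close>.\<close>

lemma regular_at_step:
  assumes "x \<in> roots" "y \<in> roots" "regular_at y" "ip x y = 1" shows "regular_at x"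
proof -
  obtain a b c d e where x: "x = (a, b, c, d, e)" by (cases x)
  obtain a1 b1 c1 d1 e1 where y: "y = (a1, b1, c1, d1, e1)" by (cases y)
  let ?r = "(a - a1, b - b1, c - c1, d - d1, e - e1)"
  have "ip ?r ?r = ip x x - 2 * ip x y + ip y y" "ip ?r y = ip x y - ip y y"
    unfolding x y by (simp_all add: algebra_simps)
  then have r: "?r \<in> roots" "ip ?r y = - 1" using assms by (simp_all add: roots_def)
  then have "reflect ?r y = x" by (simp add: x y)
  then show ?thesis using regular_at_reflect[OF r(1) assms(3)] by simp
qed

lemma rel_tuple: "rel (a, b, c, d, e) (a', b', c', d', e') =
   (let k = a * a' + b * b' + c * c' + d * d' + e * e' in
    if k = 2 then 0 else if k = 1 then 1 else if k = - 2 then 3 else if k = - 1 then 5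
    else if even (a - a') \<and> even (b - b') \<and> even (c - c') \<and> even (d - d') \<and> even (e - e') then 2
    else 4)"
  by (simp add: rel_def)

lemma rel_base_root: "z \<in> set (layers ! i) \<Longrightarrow> i \<le> 5 \<Longrightarrow> rel base_root z = i"
  by (erule le5_cases) (auto simp: layers_def base_root_def rel_tuple)

text \<open>An evaluable form of regularity at \<open>base_root\<close>: layer \<open>i\<close>
  lists the roots in relation \<open>i\<close> with \<open>base_root\<close>, so entry
  \<open>(i, j)\<close> of the computed table counts the \<open>z\<close> with indices
  \<open>i\<close> and \<open>j\<close>.\<close>

definition row_ok :: "vec5 \<Rightarrow> bool" where
  "row_ok y \<longleftrightarrow> map (\<lambda>xs. map (count_list (map (rel y) xs)) [0, 1, 2, 3, 4, 5]) layers
    = scheme40_numbers ! rel base_root y"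

lemma all_rows_ok: "list_all row_ok (concat layers)"
proof -
  have *: "row_ok y \<longleftrightarrow> map (\<lambda>xs. map (count_list (map (rel y) xs)) [0, 1, 2, 3, 4, 5]) layers
    = scheme40_numbers ! rel (1,1,0,0,0) y" for y
    by (simp add: row_ok_def base_root_def)
  show ?thesis
    unfolding layers_def concat.simps append.simps list.pred_inject
    by (intro conjI TrueI; simp add: * layers_def rel_tuple scheme40_numbers_def)
qed

lemma regular_at_base_root: "regular_at base_root"
  unfolding regular_at_def
proof (intro ballI allI impI)
  fix y i j assume y: "y \<in> roots" and ij: "i \<le> (5::nat)" "j \<le> (5::nat)"
  have len: "length layers = 6" by (simp add: layers_def)
  have mem: "z \<in> roots \<and> rel base_root z = i \<longleftrightarrow> z \<in> set (layers ! i)" for z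
  proof
    assume z: "z \<in> roots \<and> rel base_root z = i"
    then obtain xs where "xs \<in> set layers" "z \<in> set xs"
      by (auto simp flip: set_layers)
    then obtain k where "k < 6" "z \<in> set (layers ! k)"
      using len by (auto simp: in_set_conv_nth[of xs])
    moreover from this have "k = i" using rel_base_root[of z k] z by simp
    ultimately show "z \<in> set (layers ! i)" by simp
  next
    assume "z \<in> set (layers ! i)"
    then show "z \<in> roots \<and> rel base_root z = i"
      using rel_base_root[of z i] ij len by (auto simp flip: set_layers)
  qed
  \<comment> \<open>The equation \<open>j = rel y z\<close> is oriented so that the length of the
    filtered list turns into a \<open>count_list\<close>; distinctness of the layers turns that
    length into a cardinality.\<close>
  have "{z \<in> roots. rel base_root z = i \<and> rel z y = j} = set (filter (\<lambda>z. j = rel y z) (layers ! i))"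
    unfolding set_filter using mem rel_comm[of y] by (intro Collect_cong) metis
  moreover have "distinct (filter (\<lambda>z. j = rel y z) (layers ! i))"
    using distinct_layers len ij by (simp add: distinct_concat_iff)
  ultimately have "card {z \<in> roots. rel base_root z = i \<and> rel z y = j}
      = length (filter (\<lambda>z. j = rel y z) (layers ! i))"
    by (simp only: distinct_card)
  also have "\<dots> = count_list (map (rel y) (layers ! i)) j"
    by (simp add: count_list_eq_length_filter filter_map comp_def)
  also have "\<dots> = map (\<lambda>xs. map (count_list (map (rel y) xs)) [0, 1, 2, 3, 4, 5]) layers ! i ! j"
    using ij len by (auto elim!: le5_cases)
  also have "\<dots> = scheme40_numbers ! rel base_root y ! i ! j"
    using all_rows_ok y unfolding list_all_iff set_layers row_ok_def by simp
  finally show "card {z \<in> roots. rel base_root z = i \<and> rel z y = j}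
      = scheme40_numbers ! rel base_root y ! i ! j" .
qed

text \<open>Regularity spreads along pairs with inner product 1: from \<open>base_root\<close> to
  layer 1, from there to all roots but the negative of \<open>base_root\<close>, which has inner
  product -1 with all of layer 1. One further step through \<open>(-1, 0, 1, 0, 0)\<close> reaches
  it.\<close>

lemma regular_at_root:
  assumes "x \<in> roots" shows "regular_at x"
proof -
  have layer1: "regular_at y" if "y \<in> set (layers ! 1)" for y
  proof (rule regular_at_step[OF _ _ regular_at_base_root])
    show "y \<in> roots" "base_root \<in> roots" "ip y base_root = 1"
      using that by (auto simp: layers_def roots_def base_root_def)
  qed
  have sub: "set (layers ! 1) \<subseteq> roots"
    by (simp add: layers_def roots_def)
  have "list_all (\<lambda>x. x = (-1, -1, 0, 0, 0) \<or> list_ex (\<lambda>y. ip x y = 1) (layers ! 1)) (concat layers)"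
    by (simp add: layers_def)
  then have near: "regular_at x" if "x \<in> roots" "x \<noteq> (-1, -1, 0, 0, 0)" for x
    using that layer1 sub regular_at_step
    unfolding list_all_iff list_ex_iff set_layers by blast
  show ?thesis
  proof (cases "x = (-1, -1, 0, 0, 0)")
    case True
    show ?thesis
    proof (rule regular_at_step[OF assms])
      show "(-1, 0, 1, 0, 0) \<in> roots" "regular_at (-1, 0, 1, 0, 0)"
        by (auto intro!: near simp: roots_def)
      show "ip x (-1, 0, 1, 0, 0) = 1" using True by simp
    qed
  qed (simp add: near assms)
qed

text \<open>The squared lengths of \<open>v - w\<close> and \<open>v + w\<close> are
  \<open>4 - 2 * ip v w\<close> and \<open>4 + 2 * ip v w\<close>. Both are nonnegative, and the
  first vanishes only for \<open>v = w\<close>.\<close>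

lemma ip_roots_abs_le:
  assumes "v \<in> roots" "w \<in> roots"
  shows "\<bar>ip v w\<bar> \<le> 2" and "ip v w = 2 \<longleftrightarrow> v = w"
proof -
  obtain a b c d e where v: "v = (a, b, c, d, e)" by (cases v)
  obtain a' b' c' d' e' where w: "w = (a', b', c', d', e')" by (cases w)
  have eq: "(a - a')\<^sup>2 + (b - b')\<^sup>2 + (c - c')\<^sup>2 + (d - d')\<^sup>2 + (e - e')\<^sup>2 = 4 - 2 * ip v w"
    "(a + a')\<^sup>2 + (b + b')\<^sup>2 + (c + c')\<^sup>2 + (d + d')\<^sup>2 + (e + e')\<^sup>2 = 4 + 2 * ip v w"
    using assms by (simp_all add: v w roots_def power2_eq_square algebra_simps)
  have pos: "0 \<le> (a - a')\<^sup>2" "0 \<le> (b - b')\<^sup>2" "0 \<le> (c - c')\<^sup>2" "0 \<le> (d - d')\<^sup>2" "0 \<le> (e - e')\<^sup>2"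
    "0 \<le> (a + a')\<^sup>2" "0 \<le> (b + b')\<^sup>2" "0 \<le> (c + c')\<^sup>2" "0 \<le> (d + d')\<^sup>2" "0 \<le> (e + e')\<^sup>2"
    by simp_all
  show "\<bar>ip v w\<bar> \<le> 2" using eq pos by linarith
  show "ip v w = 2 \<longleftrightarrow> v = w"
  proof
    assume "ip v w = 2"
    with eq(1) pos have "(a - a')\<^sup>2 = 0" "(b - b')\<^sup>2 = 0" "(c - c')\<^sup>2 = 0" "(d - d')\<^sup>2 = 0" "(e - e')\<^sup>2 = 0"
      by linarith+
    then show "v = w" by (simp add: v w)
  next
    assume "v = w"
    then show "ip v w = 2" using assms by (simp add: roots_def)
  qed
qed

lemma scheme40_roots: "scheme40 roots rel"
proof
  show "finite roots" by (rule finite_roots)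
  show "roots \<noteq> {}" using card_roots by auto
  fix x y assume xy: "x \<in> roots" "y \<in> roots"
  show "rel x y \<le> 5" "rel x y = rel y x" by (rule rel_le5, rule rel_comm)
  show "rel x y = 0 \<longleftrightarrow> x = y"
    using ip_roots_abs_le(2)[OF xy] by (auto simp: rel_def Let_def)
  fix i j :: nat assume "i \<le> 5" "j \<le> 5"
  then show "card {z \<in> roots. rel x z = i \<and> rel z y = j} = scheme40_numbers ! rel x y ! i ! j"
    using regular_at_root[OF xy(1)] xy(2) unfolding regular_at_def by blast
qed

section \<open>Coordinates for an arbitrary scheme\<close>

text \<open>For positive \<open>c\<close>, \<open>G / c\<close> is an orthogonal projection and the
  \<open>u i\<close>, divided by the square root of \<open>c\<close>, are orthonormal vectors in its
  image. By the trace condition they are as many as its rank, so they span the image. Scaling by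
  \<open>c\<close> avoids division, which lets the lemma apply to integers.\<close>

lemma projection_eq_sum_orthonormal:
  fixes G :: "'a \<Rightarrow> 'a \<Rightarrow> 'b::linordered_idom" and u :: "'i \<Rightarrow> 'a \<Rightarrow> 'b"
  assumes fin: "finite X" "finite K"
    and sym: "\<And>x y. x \<in> X \<Longrightarrow> y \<in> X \<Longrightarrow> G x y = G y x"
    and idem: "\<And>x y. x \<in> X \<Longrightarrow> y \<in> X \<Longrightarrow> (\<Sum>z\<in>X. G x z * G z y) = c * G x y"
    and eig: "\<And>i x. i \<in> K \<Longrightarrow> x \<in> X \<Longrightarrow> (\<Sum>z\<in>X. G x z * u i z) = c * u i x"
    and orth: "\<And>i j. i \<in> K \<Longrightarrow> j \<in> K \<Longrightarrow> (\<Sum>z\<in>X. u i z * u j z) = (if i = j then c else 0)"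
    and trace: "(\<Sum>x\<in>X. G x x) = c * of_nat (card K)"
    and xy: "x \<in> X" "y \<in> X"
  shows "G x y = (\<Sum>i\<in>K. u i x * u i y)"
proof -
  define w where "w x z = G x z - (\<Sum>i\<in>K. u i x * u i z)" for x z
  \<comment> \<open>Bessel: the rows of the residual w have nonnegative square sums, whose total vanishes by the
    trace condition.\<close>
  have row: "(\<Sum>z\<in>X. (w x z)\<^sup>2) = c * (G x x - (\<Sum>i\<in>K. (u i x)\<^sup>2))" if x: "x \<in> X" for x
  proof -
    have "(w x z)\<^sup>2 = G x z * G z x - 2 * (\<Sum>i\<in>K. u i x * (G x z * u i z))
        + (\<Sum>i\<in>K. \<Sum>j\<in>K. u i x * u j x * (u i z * u j z))" if "z \<in> X" for z
      using sym[OF x that]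
      by (simp add: w_def power2_diff power2_eq_square sum_product sum_distrib_left sum_distrib_right algebra_simps)
    then have "(\<Sum>z\<in>X. (w x z)\<^sup>2) = (\<Sum>z\<in>X. G x z * G z x)
        - 2 * (\<Sum>z\<in>X. \<Sum>i\<in>K. u i x * (G x z * u i z))
        + (\<Sum>z\<in>X. \<Sum>i\<in>K. \<Sum>j\<in>K. u i x * u j x * (u i z * u j z))"
      by (simp add: sum.distrib sum_subtractf sum_distrib_left)
    also have "(\<Sum>z\<in>X. \<Sum>i\<in>K. u i x * (G x z * u i z)) = (\<Sum>i\<in>K. u i x * (\<Sum>z\<in>X. G x z * u i z))"
      by (subst sum.swap) (simp add: sum_distrib_left)
    also have "\<dots> = (\<Sum>i\<in>K. c * (u i x)\<^sup>2)"
      using eig x by (intro sum.cong) (auto simp: power2_eq_square)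
    also have "(\<Sum>z\<in>X. \<Sum>i\<in>K. \<Sum>j\<in>K. u i x * u j x * (u i z * u j z))
        = (\<Sum>i\<in>K. \<Sum>j\<in>K. u i x * u j x * (\<Sum>z\<in>X. u i z * u j z))"
      by (subst sum.swap, rule sum.cong[OF refl], subst sum.swap) (simp add: sum_distrib_left)
    also have "\<dots> = (\<Sum>i\<in>K. \<Sum>j\<in>K. if i = j then c * (u i x)\<^sup>2 else 0)"
      using orth by (intro sum.cong) (auto simp: power2_eq_square)
    also have "\<dots> = (\<Sum>i\<in>K. c * (u i x)\<^sup>2)" using fin by simp
    finally show ?thesis unfolding idem[OF x x] by (simp add: algebra_simps flip: sum_distrib_left)
  qed
  have "(\<Sum>x\<in>X. \<Sum>z\<in>X. (w x z)\<^sup>2) = c * ((\<Sum>x\<in>X. G x x) - (\<Sum>x\<in>X. \<Sum>i\<in>K. (u i x)\<^sup>2))"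
    by (simp add: row sum_subtractf flip: sum_distrib_left)
  also have "(\<Sum>x\<in>X. \<Sum>i\<in>K. (u i x)\<^sup>2) = (\<Sum>i\<in>K. \<Sum>x\<in>X. u i x * u i x)"
    by (subst sum.swap) (simp add: power2_eq_square)
  also have "\<dots> = c * of_nat (card K)" using orth by simp
  finally have "(\<Sum>x\<in>X. \<Sum>z\<in>X. (w x z)\<^sup>2) = 0" using trace by simp
  then have "(w x y)\<^sup>2 = 0"
    using fin xy by (simp add: sum_nonneg_eq_0_iff sum_nonneg)
  then show ?thesis by (simp add: w_def)
qed

text \<open>The inner product of two roots in the \<open>i\<close>-th relation.\<close>

definition gram :: "nat \<Rightarrow> int" where
  "gram i = [2, 1, 0, - 2, 0, - 1] ! i"

lemma gram_rel:
  assumes "v \<in> roots" "w \<in> roots" shows "gram (rel v w) = ip v w"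
proof -
  have "ip v w \<in> {-2, -1, 0, 1, 2}" using ip_roots_abs_le(1)[OF assms] by auto
  then show ?thesis by (auto simp: rel_def gram_def Let_def)
qed

text \<open>The identity \<open>G\<^sup>2 = 16 G\<close>, evaluated on a pair in relation
  \<open>h\<close>.\<close>

lemma numbers_gram:
  "h \<le> 5 \<Longrightarrow> (\<Sum>i\<le>5. \<Sum>j\<le>5. int (scheme40_numbers ! h ! i ! j) * (gram i * gram j)) = 16 * gram h"
  by (erule le5_cases) (simp_all add: scheme40_numbers_def gram_def numeral_eq_Suc)

text \<open>The numbers \<open>p\<^sup>i\<^sub>1\<^sub>1\<close> separate the relations 2 and 4, which share the inner product 0.\<close>

lemma numbers_11: "i \<le> 5 \<Longrightarrow> scheme40_numbers ! i ! 1 ! 1 = [12, 5, 6, 0, 4, 1] ! i"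
  by (erule le5_cases) (simp_all add: scheme40_numbers_def)

text \<open>Needed for integrality: it makes half the sum of two rows of the Gram matrix integral
  when the rows belong to vertices in relation 2.\<close>

lemma numbers_2_even:
  assumes "i \<le> 5" "j \<le> 5" "scheme40_numbers ! 2 ! i ! j \<noteq> 0"
  shows "even (gram i + gram j)"
proof -
  have "i \<in> {0, 1, 2, 3, 4, 5}" "j \<in> {0, 1, 2, 3, 4, 5}" using assms(1,2) by auto
  then show ?thesis
    using assms(3) by (elim insertE emptyE; simp add: gram_def scheme40_numbers_def)
qed

text \<open>Relation 4 absorbs relation 2: a step in relation 4 followed by one in relation 2 can
  only end in relation 4.\<close>

lemma numbers_42: "i \<le> 5 \<Longrightarrow> scheme40_numbers ! i ! 4 ! 2 \<noteq> 0 \<Longrightarrow> i = 4"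
  by (erule le5_cases) (simp_all add: scheme40_numbers_def)

section \<open>Integral eigenvectors and the embedding into the roots\<close>

context scheme40
begin

text \<open>Group the vertices \<open>z\<close> by the pair \<open>(f x z, f z y)\<close>; the size
  of each group is an intersection number.\<close>

lemma sum_by_index:
  fixes F :: "nat \<Rightarrow> nat \<Rightarrow> int"
  assumes "x \<in> X" "y \<in> X"
  shows "(\<Sum>z\<in>X. F (f x z) (f z y)) = (\<Sum>i\<le>5. \<Sum>j\<le>5. int (scheme40_numbers ! f x y ! i ! j) * F i j)"
proof -
  have "(\<Sum>z\<in>X. F (f x z) (f z y)) = (\<Sum>z\<in>X. \<Sum>i\<le>5. \<Sum>j\<le>5. if f x z = i \<and> f z y = j then F i j else 0)"
  proof (rule sum.cong)
    fix z assume z: "z \<in> X"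
    have "(\<Sum>i\<le>5. \<Sum>j\<le>5. if f x z = i \<and> f z y = j then F i j else 0)
        = (\<Sum>i\<le>5. if f x z = i then \<Sum>j\<le>5. if f z y = j then F i j else 0 else 0)"
      by (intro sum.cong) auto
    also have "\<dots> = F (f x z) (f z y)"
      using le5 assms z by simp
    finally show "F (f x z) (f z y) = (\<Sum>i\<le>5. \<Sum>j\<le>5. if f x z = i \<and> f z y = j then F i j else 0)" ..
  qed simp
  also have "\<dots> = (\<Sum>i\<le>5. \<Sum>j\<le>5. \<Sum>z\<in>X. if f x z = i \<and> f z y = j then F i j else 0)"
    by (subst sum.swap, rule sum.cong[OF refl], subst sum.swap) simp
  also have "\<dots> = (\<Sum>i\<le>5. \<Sum>j\<le>5. int (scheme40_numbers ! f x y ! i ! j) * F i j)"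
  proof (intro sum.cong refl)
    fix i j :: nat assume ij: "i \<in> {..5}" "j \<in> {..5}"
    have "(\<Sum>z\<in>X. if f x z = i \<and> f z y = j then F i j else 0) = (\<Sum>z\<in>{z\<in>X. f x z = i \<and> f z y = j}. F i j)"
      by (rule sum.inter_filter[OF fin, symmetric])
    then show "(\<Sum>z\<in>X. if f x z = i \<and> f z y = j then F i j else 0)
        = int (scheme40_numbers ! f x y ! i ! j) * F i j"
      using count[OF assms, of i j] ij by simp
  qed
  finally show ?thesis .
qed

lemma card_vertices: "card X = 40"
proof -
  obtain x where x: "x \<in> X" using ne by blast
  have "int (card X) = (\<Sum>z\<in>X. (\<lambda>_ _. 1) (f x z) (f z x))" by simp
  also have "\<dots> = (\<Sum>i\<le>5. \<Sum>j\<le>5. int (scheme40_numbers ! 0 ! i ! j) * 1)"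
    using sum_by_index[OF x x, of "\<lambda>_ _. 1"] eq0[OF x x] by simp
  also have "\<dots> = 40" by (simp add: scheme40_numbers_def numeral_eq_Suc)
  finally show ?thesis by simp
qed

abbreviation G :: "'a \<Rightarrow> 'a \<Rightarrow> int" where "G x y \<equiv> gram (f x y)"

lemma gram_square:
  assumes "x \<in> X" "y \<in> X" shows "(\<Sum>z\<in>X. G x z * G z y) = 16 * G x y"
  using sum_by_index[OF assms, of "\<lambda>i j. gram i * gram j"] numbers_gram[of "f x y"] le5[OF assms] by simp

lemma gram_diag: "x \<in> X \<Longrightarrow> G x x = 2"
  using eq0[of x x] by (simp add: gram_def)

lemma gram_eq_2:
  assumes "x \<in> X" "y \<in> X" "G x y = 2" shows "x = y"
proof -
  have "f x y = 0"
    using assms(3) by - (rule le5_cases[OF le5[OF assms(1,2)]]; simp add: gram_def)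
  then show ?thesis using eq0 assms by simp
qed

text \<open>The vertex \<open>z\<close> is itself among those counted. Read contrapositively, zero
  entries of the table forbid configurations.\<close>

lemma numbers_pos:
  "x \<in> X \<Longrightarrow> y \<in> X \<Longrightarrow> z \<in> X \<Longrightarrow> scheme40_numbers ! f x y ! f x z ! f z y \<noteq> 0"
proof -
  assume xyz: "x \<in> X" "y \<in> X" "z \<in> X"
  then have "z \<in> {w \<in> X. f x w = f x z \<and> f w y = f z y}" by simp
  then have "card {w \<in> X. f x w = f x z \<and> f w y = f z y} \<noteq> 0" using fin by auto
  then show ?thesis using count[of x y "f x z" "f z y"] le5 xyz by simp
qed

lemma exists_vertex:
  assumes "x \<in> X" "y \<in> X" "i \<le> 5" "j \<le> 5" "scheme40_numbers ! f x y ! i ! j \<noteq> 0"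
  obtains z where "z \<in> X" "f x z = i" "f z y = j"
proof -
  have "card {z \<in> X. f x z = i \<and> f z y = j} \<noteq> 0" using count assms by simp
  then have "{z \<in> X. f x z = i \<and> f z y = j} \<noteq> {}" by force
  then show thesis using that by blast
qed

text \<open>The five vertices play the roles of e1 + e2, e1 - e2, e3 + e4, e3 - e4 and e1 + e5, and
  are found through nonzero intersection numbers.\<close>

lemma frame:
  obtains a b c d t where "a \<in> X" "b \<in> X" "c \<in> X" "d \<in> X" "t \<in> X" "f a b = 2" "f c d = 2"
    "f a c = 4" "f b c = 4" "f a d = 4" "f b d = 4" "f a t = 1" "f b t = 1" "f c t = 4" "f d t = 4"
proof -
  obtain a where a: "a \<in> X" using ne by blast
  obtain c where c: "c \<in> X" "f a c = 4"
    using exists_vertex[of a a 4 4] a eq0[OF a a] by (auto simp: scheme40_numbers_def)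
  obtain d where d: "d \<in> X" "f c d = 2"
    using exists_vertex[of c c 2 2] c eq0[of c c] by (auto simp: scheme40_numbers_def)
  obtain t where t: "t \<in> X" "f a t = 1" "f t c = 4"
    using exists_vertex[of a c 1 4] a c by (auto simp: scheme40_numbers_def)
  \<comment> \<open>\<open>b\<close> is chosen after \<open>t\<close>: of the two vertices in
    relation 2 with \<open>a\<close>, exactly one is in relation 1 with \<open>t\<close>, as
    \<open>p\<^sup>1\<^sub>2\<^sub>1 = 1\<close>.\<close>
  obtain b where b: "b \<in> X" "f a b = 2" "f b t = 1"
    using exists_vertex[of a t 2 1] a t by (auto simp: scheme40_numbers_def)
  have tr: "f x y = 4" if "x \<in> X" "y \<in> X" "z \<in> X" "f x z = 4" "f z y = 2" for x y z
    using numbers_42[of "f x y"] numbers_pos[OF that(1-3)] le5[OF that(1,2)] that(4,5) by simp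
  have "f a d = 4" "f c b = 4" "f t d = 4"
    using tr a b c d t comm by metis+
  moreover from this have "f b d = 4" using tr[of d b a] a b d comm by metis
  ultimately show thesis using that[of a b c d t] a b c d t comm by auto
qed

lemma fiber_even:
  assumes "a \<in> X" "b \<in> X" "f a b = 2" "x \<in> X" shows "even (G a x + G b x)"
  using numbers_2_even[of "f a x" "f x b"] numbers_pos[of a b x] le5 assms comm[of b x] by simp

lemma coordinates:
  "\<exists>u :: nat \<Rightarrow> 'a \<Rightarrow> int. \<forall>x\<in>X. \<forall>y\<in>X. G x y = (\<Sum>i<5. u i x * u i y)"
proof -
  obtain a b c d t where X: "a \<in> X" "b \<in> X" "c \<in> X" "d \<in> X" "t \<in> X" and fr: "f a b = 2" "f c d = 2"
    "f a c = 4" "f b c = 4" "f a d = 4" "f b d = 4" "f a t = 1" "f b t = 1" "f c t = 4" "f d t = 4"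
    by (rule frame)
  \<comment> \<open>Under the intended identification a, b = e1 \<plusminus> e2, c, d = e3 \<plusminus> e4 and t = e1 + e5, so that
    u i x is the inner product of x with the i-th standard basis vector; v = 2 u avoids division.\<close>
  define u where "u i x = [(G a x + G b x) div 2, (G a x - G b x) div 2,
    (G c x + G d x) div 2, (G c x - G d x) div 2, G t x - (G a x + G b x) div 2] ! i" for i :: nat and x
  define v where "v i x = [G a x + G b x, G a x - G b x, G c x + G d x, G c x - G d x,
    2 * G t x - G a x - G b x] ! i" for i :: nat and x
  have i5: "i = 0 \<or> i = 1 \<or> i = 2 \<or> i = 3 \<or> i = 4" if "i < 5" for i :: nat using that by linarith
  \<comment> \<open>By \<open>fiber_even\<close> all the halvings in \<open>u\<close> are
    exact.\<close>
  have vu: "v i x = 2 * u i x" if "i < 5" "x \<in> X" for i x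
  proof -
    have "even (G a x + G b x)" "even (G c x + G d x)" using fiber_even X fr that by auto
    then have "even (G a x - G b x)" "even (G c x - G d x)" by auto
    then show ?thesis using \<open>even (G a x + G b x)\<close> \<open>even (G c x + G d x)\<close> i5[OF that(1)]
      by (auto simp: u_def v_def)
  qed
  have fr': "f b a = 2" "f d c = 2" "f c a = 4" "f c b = 4" "f d a = 4" "f d b = 4"
    "f t a = 1" "f t b = 1" "f t c = 4" "f t d = 4"
    using fr X comm by metis+
  have diag: "f a a = 0" "f b b = 0" "f c c = 0" "f d d = 0" "f t t = 0"
    using eq0 X by simp_all
  have sq: "(\<Sum>z\<in>X. G p z * G q z) = 16 * G p q" if "p \<in> X" "q \<in> X" for p q
    using gram_square[OF that] comm[OF _ that(2)] by simp
  note gsimps = sum.distrib sum_subtractf sum_distrib_left[symmetric] sum_distrib_right[symmetric] sq X fr fr' diag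
  \<comment> \<open>Each \<open>v i\<close> is a combination of rows of \<open>G\<close>, and these
    are eigenvectors for 16 because \<open>G\<^sup>2 = 16 G\<close>.\<close>
  have eigv: "(\<Sum>z\<in>X. G x z * v i z) = 16 * v i x" if "x \<in> X" "i < 5" for x i
    using i5[OF that(2)] that(1)
    by (elim disjE) (simp_all add: v_def distrib_left right_diff_distrib mult.left_commute[of _ 2]
        gsimps comm[OF that(1) X(1)] comm[OF that(1) X(2)] comm[OF that(1) X(3)]
        comm[OF that(1) X(4)] comm[OF that(1) X(5)])
  \<comment> \<open>Expanding \<open>v j\<close> into rows of \<open>G\<close> at frame vertices and
    using the eigenvector equation reduces the sum to values of \<open>v i\<close> on the frame,
    where \<open>G\<close> is known. Since \<open>v i\<close> corresponds to twice a basis vector,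
    the norm is 16 * 4.\<close>
  have orthv: "(\<Sum>z\<in>X. v i z * v j z) = (if i = j then 64 else 0)" if "i < 5" "j < 5" for i j
  proof -
    have lin: "(\<Sum>z\<in>X. v i z * G p z) = 16 * v i p" if "p \<in> X" for p
      using eigv[OF that \<open>i < 5\<close>] by (simp add: mult.commute)
    have "v 0 = (\<lambda>z. G a z + G b z)" "v 1 = (\<lambda>z. G a z - G b z)" "v 2 = (\<lambda>z. G c z + G d z)"
      "v 3 = (\<lambda>z. G c z - G d z)" "v 4 = (\<lambda>z. 2 * G t z - G a z - G b z)"
      by (simp_all add: v_def fun_eq_iff)
    then have "(\<Sum>z\<in>X. v i z * v j z) = 16 * [v i a + v i b, v i a - v i b, v i c + v i d, v i c - v i d,
        2 * v i t - v i a - v i b] ! j"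
      using i5[OF that(2)]
      by (elim disjE) (simp_all add: distrib_left right_diff_distrib mult.left_commute[of _ 2]
          sum.distrib sum_subtractf lin X flip: sum_distrib_left)
    also have "\<dots> = (if i = j then 64 else 0)"
      using i5[OF that(1)] i5[OF that(2)] by (elim disjE) (simp_all add: v_def fr fr' diag gram_def)
    finally show ?thesis .
  qed
  have "G x y = (\<Sum>i<5. u i x * u i y)" if "x \<in> X" "y \<in> X" for x y
  proof (rule projection_eq_sum_orthonormal[where c = 16 and X = X])
    show "(\<Sum>z\<in>X. G x z * u i z) = 16 * u i x" if "i \<in> {..<5}" "x \<in> X" for i x
    proof -
      have "2 * (\<Sum>z\<in>X. G x z * u i z) = (\<Sum>z\<in>X. G x z * v i z)"
        using that by (simp add: vu sum_distrib_left mult_ac)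
      then show ?thesis using eigv vu that by simp
    qed
    show "(\<Sum>z\<in>X. u i z * u j z) = (if i = j then 16 else 0)" if "i \<in> {..<5}" "j \<in> {..<5}" for i j
    proof -
      have "4 * (\<Sum>z\<in>X. u i z * u j z) = (\<Sum>z\<in>X. v i z * v j z)"
        using that by (simp add: vu sum_distrib_left mult_ac)
      then show ?thesis using orthv that by (simp split: if_splits)
    qed
    \<comment> \<open>Both sides are 80: forty diagonal entries 2, against five vectors of norm
      16.\<close>
    show "(\<Sum>x\<in>X. G x x) = 16 * of_nat (card {..<5::nat})"
      using card_vertices by (simp add: gram_diag)
  qed (use fin gram_square comm that in auto)
  then show ?thesis by blast
qed

text \<open>The coordinates embed the vertices into the roots, injectively since inner product 2
  means equality, and onto since both sets have 40 elements. Inner products then determine every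
  index up to exchanging 2 and 4, and \<open>p\<^sup>h\<^sub>1\<^sub>1\<close> settles that
  ambiguity.\<close>

lemma root_coordinates:
  "\<exists>e. bij_betw e X roots \<and> (\<forall>x\<in>X. \<forall>y\<in>X. f x y = rel (e x) (e y))"
proof -
  obtain u :: "nat \<Rightarrow> 'a \<Rightarrow> int" where u: "\<And>x y. x \<in> X \<Longrightarrow> y \<in> X \<Longrightarrow> G x y = (\<Sum>i<5. u i x * u i y)"
    using coordinates by meson
  define e where "e x = (u 0 x, u 1 x, u 2 x, u 3 x, u 4 x)" for x
  have ip_e: "ip (e x) (e y) = G x y" if "x \<in> X" "y \<in> X" for x y
    unfolding u[OF that] by (simp add: e_def eval_nat_numeral)
  have sub: "e ` X \<subseteq> roots" using ip_e gram_diag by (auto simp: roots_def)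
  have inj: "inj_on e X"
  proof (rule inj_onI)
    fix x y assume "x \<in> X" "y \<in> X" "e x = e y"
    then have "G x y = 2" using ip_e gram_diag by metis
    then show "x = y" using gram_eq_2 \<open>x \<in> X\<close> \<open>y \<in> X\<close> by blast
  qed
  then have bij: "bij_betw e X roots"
    using card_subset_eq[OF finite_roots sub] card_vertices card_roots
    by (simp add: bij_betw_def card_image)
  have gr: "gram (rel (e x) (e y)) = G x y" if "x \<in> X" "y \<in> X" for x y
    using gram_rel[of "e x" "e y"] ip_e that sub by auto
  have gram_1: "gram i = 1 \<longleftrightarrow> i = 1" if "i \<le> 5" for i
    by (rule le5_cases[OF that]) (simp_all add: gram_def)
  \<comment> \<open>Only index 1 has inner product 1, so relation 1 is known to be preserved before
    2 and 4 are told apart. This suffices to compare the numbers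
    \<open>p\<^sup>h\<^sub>1\<^sub>1\<close> on both sides.\<close>
  have one: "rel (e x) (e y) = 1 \<longleftrightarrow> f x y = 1" if "x \<in> X" "y \<in> X" for x y
    using gr[OF that] gram_1 rel_le5 le5[OF that] by metis
  have p11: "scheme40_numbers ! f x y ! 1 ! 1 = scheme40_numbers ! rel (e x) (e y) ! 1 ! 1"
    if "x \<in> X" "y \<in> X" for x y
  proof -
    have img: "{w \<in> roots. rel (e x) w = 1 \<and> rel w (e y) = 1} = e ` {z \<in> X. f x z = 1 \<and> f z y = 1}"
    proof -
      have "{w \<in> roots. rel (e x) w = 1 \<and> rel w (e y) = 1}
          = e ` {z \<in> X. rel (e x) (e z) = 1 \<and> rel (e z) (e y) = 1}"
        unfolding bij_betw_imp_surj_on[OF bij, symmetric] by blast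
      also have "{z \<in> X. rel (e x) (e z) = 1 \<and> rel (e z) (e y) = 1} = {z \<in> X. f x z = 1 \<and> f z y = 1}"
        using one that by blast
      finally show ?thesis .
    qed
    have "card (e ` {z \<in> X. f x z = 1 \<and> f z y = 1}) = card {z \<in> X. f x z = 1 \<and> f z y = 1}"
      by (intro card_image inj_on_subset[OF inj]) auto
    moreover have "card {w \<in> roots. rel (e x) w = 1 \<and> rel w (e y) = 1}
        = scheme40_numbers ! rel (e x) (e y) ! 1 ! 1"
      by (rule scheme40.count[OF scheme40_roots]) (use sub that in auto)
    moreover have "card {z \<in> X. f x z = 1 \<and> f z y = 1} = scheme40_numbers ! f x y ! 1 ! 1"
      by (rule count[OF that]) simp_all
    ultimately show ?thesis unfolding img by metis
  qed
  have sep: "i = j" if "i \<le> 5" "j \<le> 5" "gram i = gram j"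
    "scheme40_numbers ! i ! 1 ! 1 = scheme40_numbers ! j ! 1 ! 1" for i j
  proof -
    have "i \<in> {0, 1, 2, 3, 4, 5}" "j \<in> {0, 1, 2, 3, 4, 5}" using that(1,2) by auto
    then show ?thesis
      using that(3,4) unfolding numbers_11[OF that(1)] numbers_11[OF that(2)]
      by (elim insertE emptyE; simp add: gram_def)
  qed
  have "f x y = rel (e x) (e y)" if "x \<in> X" "y \<in> X" for x y
    using sep[OF le5[OF that] rel_le5 gr[OF that, symmetric] p11[OF that]] .
  then show ?thesis using bij by blast
qed

end

section \<open>Uniqueness up to isomorphism and existence\<close>

lemma indexed_relations_isomorphic:
  assumes \<phi>: "bij_betw \<phi> X Y" and inj: "inj_on R K" "inj_on S K"
    and iff: "\<And>x y i. x \<in> X \<Longrightarrow> y \<in> X \<Longrightarrow> i \<in> K \<Longrightarrow> (x, y) \<in> R i \<longleftrightarrow> (\<phi> x, \<phi> y) \<in> S i"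
  shows "scheme_isomorphic X (R ` K) Y (S ` K)"
  unfolding scheme_isomorphic_def
proof (intro exI conjI ballI)
  let ?\<psi> = "\<lambda>r. S (inv_into K R r)"
  show "bij_betw \<phi> X Y" by fact
  have "bij_betw (inv_into K R) (R ` K) K"
    using inj(1) by (simp add: bij_betw_inv_into inj_on_imp_bij_betw)
  then show "bij_betw ?\<psi> (R ` K) (S ` K)"
    using bij_betw_trans[of "inv_into K R" "R ` K" K S "S ` K"] inj(2)
    by (simp add: inj_on_imp_bij_betw comp_def)
  fix x y r assume "x \<in> X" "y \<in> X" "r \<in> R ` K"
  then show "(x, y) \<in> r \<longleftrightarrow> (\<phi> x, \<phi> y) \<in> ?\<psi> r"
    using iff inj(1) by auto
qed

lemma is_scheme40_inj_on:
  assumes "is_scheme40 X R" shows "inj_on R {0..5}"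
proof -
  interpret sym_assoc_scheme X "{0..5}" R
    using assms by (simp add: is_scheme40_def)
  show ?thesis
  proof (rule inj_onI)
    fix i j :: nat assume ij: "i \<in> {0..5}" "j \<in> {0..5}" "R i = R j"
    then have "R i \<inter> R j \<noteq> {}" using nonempty by simp
    then show "i = j" using disjoint ij(1,2) unfolding disjoint_family_on_def by meson
  qed
qed

text \<open>Both schemes are copies of the root scheme, so the identification of one with the roots
  followed by the inverse of the other is an isomorphism that even keeps the indices.\<close>

lemma is_scheme40_isomorphic:
  assumes "is_scheme40 X R" "is_scheme40 Y S"
  shows "scheme_isomorphic X (R ` {0..5}) Y (S ` {0..5})"
proof -
  obtain f where f: "scheme40 X f"
    and R: "\<forall>i\<le>5. R i = {(x, y). x \<in> X \<and> y \<in> X \<and> f x y = i}"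
    using is_scheme40_imp_index[OF assms(1)] by blast
  obtain g where g: "scheme40 Y g"
    and S: "\<forall>i\<le>5. S i = {(x, y). x \<in> Y \<and> y \<in> Y \<and> g x y = i}"
    using is_scheme40_imp_index[OF assms(2)] by blast
  obtain e where e: "bij_betw e X roots" "\<forall>x\<in>X. \<forall>y\<in>X. f x y = rel (e x) (e y)"
    using scheme40.root_coordinates[OF f] by blast
  obtain e' where e': "bij_betw e' Y roots" "\<forall>x\<in>Y. \<forall>y\<in>Y. g x y = rel (e' x) (e' y)"
    using scheme40.root_coordinates[OF g] by blast
  define \<phi> where "\<phi> x = inv_into Y e' (e x)" for x
  have bij: "bij_betw \<phi> X Y"
    using bij_betw_trans[OF e(1) bij_betw_inv_into[OF e'(1)]] by (simp add: \<phi>_def[abs_def] comp_def)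
  have \<phi>Y: "\<phi> x \<in> Y" if "x \<in> X" for x using bij that by (rule bij_betw_apply)
  have e\<phi>: "e' (\<phi> x) = e x" if "x \<in> X" for x
    unfolding \<phi>_def using bij_betw_inv_into_right[OF e'(1)] bij_betw_apply[OF e(1) that] by simp
  show ?thesis
  proof (rule indexed_relations_isomorphic[OF bij])
    show "(x, y) \<in> R i \<longleftrightarrow> (\<phi> x, \<phi> y) \<in> S i" if "x \<in> X" "y \<in> X" "i \<in> {0..5}" for x y i
      using that e(2) e'(2) by (simp add: R S \<phi>Y e\<phi>)
  qed (use assms in \<open>auto intro: is_scheme40_inj_on\<close>)
qed

theorem theorem6p1:
  shows "(\<exists>(X :: nat set) R. is_scheme40 X R) \<and>
    (\<forall>(X :: 'a set) R (Y :: 'b set) S. is_scheme40 X R \<longrightarrow> is_scheme40 Y S \<longrightarrow>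
      scheme_isomorphic X (R ` {0..5}) Y (S ` {0..5}))"
proof (intro conjI allI impI)
  \<comment> \<open>An encoding of integer vectors as natural numbers moves the root scheme to a
    vertex set of type \<open>nat set\<close>.\<close>
  have "bij_betw from_nat (to_nat ` roots) roots"
    by (rule bij_betw_byWitness[where f' = to_nat]) auto
  then show "\<exists>(X :: nat set) R. is_scheme40 X R"
    using index_imp_is_scheme40[OF scheme40_transport[OF scheme40_roots]] by blast
qed (rule is_scheme40_isomorphic)

end
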